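(* Every simple braid $\alpha\in\mathcal{SB}_n$ can be written in a unique way as a product $\alpha=\gamma_1\gamma_2\cdots\gamma_r$ of disjoint cycles $\gamma_1,\dots,\gamma_r\in\mathcal{MB}_n$ with $\gamma_1\prec\gamma_2\prec\cdots\prec\gamma_r$ (the case $r=0$, the empty product, corresponding to $\alpha=1$).
   Context: $\mathcal{MB}_n$ is the monoid of positive braids on $n$ strands: generators $x_1,\dots,x_{n-1}$, relations $x_ix_j=x_jx_i$ if $|i-j|\ge2$, $x_{i+1}x_ix_{i+1}=x_ix_{i+1}x_i$. A positive braid is (literally) simple if it is represented by a word $x_{i_1}\cdots x_{i_k}$ with pairwise distinct indices; $\mathcal{SB}_n\subset\mathcal{MB}_n$ is the set of simple braids. The support of a positive braid $\beta$ is $\mathrm{supp}(\beta)=\{i : \beta=\delta x_i\varepsilon \text{ for some }\delta,\varepsilon\in\mathcal{MB}_n\}$. For $1\le a\le b\le n-1$ put $U(a,b)=x_ax_{a+1}\cdots x_b$, with support $[a,b]$; for $1\le d<c\le n-1$ put $D(c,d)=x_cx_{c-1}\cdots x_d$, with support $[d,c]$ (so a single generator $x_a$ is $U(a,a)$ and is not a $D$). A cycle is a literally simple braid $\gamma\neq 1$ that is a product $F_1F_2\cdots F_m$ ($m\ge1$) in which each factor $F_i$ is some $U$ or some $D$, the supports are consecutive (if $\mathrm{supp}(F_i)=[p,q]$ then $\mathrm{supp}(F_{i+1})=[q+1,q']$ for some $q'$), and no two consecutive factors are both $U$'s. The support of a cycle is thus an integer interval. For cycles $\gamma,\gamma'$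 with $\mathrm{supp}(\gamma)=[a,b]$ and $\mathrm{supp}(\gamma')=[c,d]$, write $\gamma\prec\gamma'$ if $c\ge b+1$; when $\gamma\prec\gamma'$, the two cycles are called disjoint if moreover $c\ge b+2$. *)

theory Defs
  imports Main "HOL-Algebra.Group"
begin

section \<open>The monoid of positive braids\<close>

text \<open>The generator indices are \<open>1, \<dots>, n - 1\<close>; for \<open>n = 0\<close> and \<open>n = 1\<close> there are none.\<close>

definition gens :: "nat \<Rightarrow> nat set"
  where "gens n = {1..n - 1}"

text \<open>The least congruence on the free monoid \<open>lists (gens n)\<close> that contains the defining relations.\<close>

inductive_set braid_rel :: "nat \<Rightarrow> (nat list \<times> nat list) set" for n :: nat
  where
    comm: "i \<in> gens n \<Longrightarrow> j \<in> gens n \<Longrightarrow> \<bar>int i - int j\<bar> \<ge> 2 \<Longrightarrow> ([i, j], [j, i]) \<in> braid_rel n"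
  | braid: "i \<in> gens n \<Longrightarrow> i + 1 \<in> gens n \<Longrightarrow> ([i + 1, i, i + 1], [i, i + 1, i]) \<in> braid_rel n"
  | refl: "u \<in> lists (gens n) \<Longrightarrow> (u, u) \<in> braid_rel n"
  | sym: "(u, v) \<in> braid_rel n \<Longrightarrow> (v, u) \<in> braid_rel n"
  | trans: "(u, v) \<in> braid_rel n \<Longrightarrow> (v, w) \<in> braid_rel n \<Longrightarrow> (u, w) \<in> braid_rel n"
  | cong: "(u, u') \<in> braid_rel n \<Longrightarrow> (v, v') \<in> braid_rel n \<Longrightarrow> (u @ v, u' @ v') \<in> braid_rel n"

definition word_braid :: "nat \<Rightarrow> nat list \<Rightarrow> nat list set"
  where "word_braid n w = braid_rel n `` {w}"

definition MB :: "nat \<Rightarrow> nat list set monoid"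
  where "MB n = \<lparr>carrier = lists (gens n) // braid_rel n,
                 mult = (\<lambda>A B. \<Union>u\<in>A. \<Union>v\<in>B. word_braid n (u @ v)),
                 one = word_braid n []\<rparr>"

abbreviation gen :: "nat \<Rightarrow> nat \<Rightarrow> nat list set"
  where "gen n i \<equiv> word_braid n [i]"

lemma braid_rel_words:
  "(u, v) \<in> braid_rel n \<Longrightarrow> u \<in> lists (gens n) \<and> v \<in> lists (gens n)"
  by (induction rule: braid_rel.induct) auto

lemma equiv_braid_rel: "equiv (lists (gens n)) (braid_rel n)"
proof (rule equivI)
  show "braid_rel n \<subseteq> lists (gens n) \<times> lists (gens n)"
    by (auto dest: braid_rel_words)
  show "refl_on (lists (gens n)) (braid_rel n)"
    by (rule refl_onI) (rule braid_rel.refl)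
  show "sym (braid_rel n)"
    by (rule symI) (rule braid_rel.sym)
  show "trans (braid_rel n)"
    by (rule transI) (rule braid_rel.trans)
qed

lemma word_braid_eq_iff:
  "u \<in> lists (gens n) \<Longrightarrow> v \<in> lists (gens n) \<Longrightarrow>
    word_braid n u = word_braid n v \<longleftrightarrow> (u, v) \<in> braid_rel n"
  unfolding word_braid_def using eq_equiv_class_iff[OF equiv_braid_rel] by blast

lemma carrier_MB: "carrier (MB n) = word_braid n ` lists (gens n)"
  by (auto simp: MB_def word_braid_def quotient_def)

lemma one_MB: "\<one>\<^bsub>MB n\<^esub> = word_braid n []"
  by (simp add: MB_def)

lemma mult_word_braid:
  assumes "u \<in> lists (gens n)" "v \<in> lists (gens n)"
  shows "word_braid n u \<otimes>\<^bsub>MB n\<^esub> word_braid n v = word_braid n (u @ v)"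
proof -
  have "word_braid n (u' @ v') = word_braid n (u @ v)"
    if "u' \<in> word_braid n u" "v' \<in> word_braid n v" for u' v'
  proof -
    have r: "(u', u) \<in> braid_rel n" "(v', v) \<in> braid_rel n"
      using that unfolding word_braid_def by (blast intro: braid_rel.sym)+
    have "(u' @ v', u @ v) \<in> braid_rel n"
      using r by (rule braid_rel.cong)
    then show ?thesis
      using braid_rel_words[of "u' @ v'" "u @ v" n] word_braid_eq_iff[of "u' @ v'" n "u @ v"] by blast
  qed
  then have "(\<Union>u'\<in>word_braid n u. \<Union>v'\<in>word_braid n v. word_braid n (u' @ v')) =
      (\<Union>u'\<in>word_braid n u. \<Union>v'\<in>word_braid n v. word_braid n (u @ v))"
    by (intro SUP_cong HOL.refl) blast
  moreover have "word_braid n u \<noteq> {}" "word_braid n v \<noteq> {}"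
    using assms[THEN braid_rel.refl] unfolding word_braid_def by blast+
  ultimately show ?thesis
    by (simp add: MB_def)
qed

lemma monoid_MB: "monoid (MB n)"
proof (rule monoidI)
  have app: "u @ v \<in> lists (gens n)" if "u \<in> lists (gens n)" "v \<in> lists (gens n)" for u v
    using that by simp
  have nil: "[] \<in> lists (gens n)"
    by simp
  note word_simps = mult_word_braid app nil append_assoc append_Nil append_Nil2
  show "\<one>\<^bsub>MB n\<^esub> \<in> carrier (MB n)"
    unfolding carrier_MB one_MB using nil by (rule imageI)
  fix x y assume "x \<in> carrier (MB n)" "y \<in> carrier (MB n)"
  then obtain u v where u: "u \<in> lists (gens n)" "x = word_braid n u"
    and v: "v \<in> lists (gens n)" "y = word_braid n v"
    unfolding carrier_MB by blast
  show "x \<otimes>\<^bsub>MB n\<^esub> y \<in> carrier (MB n)"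
    unfolding carrier_MB u v using u v by (simp only: word_simps imageI)
  show "\<one>\<^bsub>MB n\<^esub> \<otimes>\<^bsub>MB n\<^esub> x = x" "x \<otimes>\<^bsub>MB n\<^esub> \<one>\<^bsub>MB n\<^esub> = x"
    unfolding one_MB u using u by (simp_all only: word_simps)
  fix z assume "z \<in> carrier (MB n)"
  then obtain w where w: "w \<in> lists (gens n)" "z = word_braid n w"
    unfolding carrier_MB by blast
  show "x \<otimes>\<^bsub>MB n\<^esub> y \<otimes>\<^bsub>MB n\<^esub> z = x \<otimes>\<^bsub>MB n\<^esub> (y \<otimes>\<^bsub>MB n\<^esub> z)"
    unfolding u v w using u v w by (simp only: word_simps)
qed

definition list_prod :: "nat \<Rightarrow> nat list set list \<Rightarrow> nat list set"
  where "list_prod n Fs = foldr (\<lambda>x y. x \<otimes>\<^bsub>MB n\<^esub> y) Fs \<one>\<^bsub>MB n\<^esub>"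


section \<open>Simple braids, supports and cycles\<close>

definition SB :: "nat \<Rightarrow> nat list set set"
  where "SB n = {word_braid n w | w. w \<in> lists (gens n) \<and> distinct w}"

definition supp :: "nat \<Rightarrow> nat list set \<Rightarrow> nat set"
  where "supp n \<beta> = {i \<in> gens n. \<exists>\<delta>\<in>carrier (MB n). \<exists>\<epsilon>\<in>carrier (MB n).
                       \<beta> = \<delta> \<otimes>\<^bsub>MB n\<^esub> gen n i \<otimes>\<^bsub>MB n\<^esub> \<epsilon>}"

definition U :: "nat \<Rightarrow> nat \<Rightarrow> nat \<Rightarrow> nat list set"
  where "U n a b = word_braid n [a..<Suc b]"

definition D :: "nat \<Rightarrow> nat \<Rightarrow> nat \<Rightarrow> nat list set"
  where "D n c d = word_braid n (rev [d..<Suc c])"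

definition is_U :: "nat \<Rightarrow> nat list set \<Rightarrow> bool"
  where "is_U n F \<longleftrightarrow> (\<exists>a b. 1 \<le> a \<and> a \<le> b \<and> b \<le> n - 1 \<and> F = U n a b)"

definition is_D :: "nat \<Rightarrow> nat list set \<Rightarrow> bool"
  where "is_D n F \<longleftrightarrow> (\<exists>c d. 1 \<le> d \<and> d < c \<and> c \<le> n - 1 \<and> F = D n c d)"

definition consecutive :: "nat \<Rightarrow> nat list set \<Rightarrow> nat list set \<Rightarrow> bool"
  where "consecutive n F G \<longleftrightarrow>
    (\<exists>p q q'. p \<le> q \<and> q + 1 \<le> q' \<and> supp n F = {p..q} \<and> supp n G = {q + 1..q'})"

definition is_cycle :: "nat \<Rightarrow> nat list set \<Rightarrow> bool"
  where "is_cycle n \<gamma> \<longleftrightarrow>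
    \<gamma> \<in> SB n \<and> \<gamma> \<noteq> \<one>\<^bsub>MB n\<^esub> \<and>
    (\<exists>Fs. Fs \<noteq> [] \<and> \<gamma> = list_prod n Fs \<and>
          (\<forall>F\<in>set Fs. is_U n F \<or> is_D n F) \<and>
          successively (consecutive n) Fs \<and>
          successively (\<lambda>F G. \<not> (is_U n F \<and> is_U n G)) Fs)"

text \<open>
  The relations \<open>prec\<close> and \<open>disjoint_cycles\<close> are meant for cycles, whose supports are nonempty
  intervals; they are false for braids with other supports.
\<close>

definition prec :: "nat \<Rightarrow> nat list set \<Rightarrow> nat list set \<Rightarrow> bool"
  where "prec n \<gamma> \<gamma>' \<longleftrightarrow>
    (\<exists>a b c d. a \<le> b \<and> c \<le> d \<and> supp n \<gamma> = {a..b} \<and> supp n \<gamma>' = {c..d} \<and> c \<ge> b + 1)"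

definition disjoint_cycles :: "nat \<Rightarrow> nat list set \<Rightarrow> nat list set \<Rightarrow> bool"
  where "disjoint_cycles n \<gamma> \<gamma>' \<longleftrightarrow> prec n \<gamma> \<gamma>' \<and>
    (\<exists>a b c d. a \<le> b \<and> c \<le> d \<and> supp n \<gamma> = {a..b} \<and> supp n \<gamma>' = {c..d} \<and> c \<ge> b + 2)"

end

theory Submission
  imports Defs
begin

text \<open>
  Words related by \<^const>\<open>braid_rel\<close> have the same length and the same letters, and between words
  with distinct letters only commutations can occur. Hence restricting such words to a set of
  letters respects the relation. Cutting the letters of a simple braid into maximal intervals
  therefore yields both the decomposition and its uniqueness: the factors are the restrictions to
  these intervals. A braid whose letters form an interval is a cycle: one adds
  the letters from the largest to the smallest, each new letter \<open>a\<close> being moved to the far left or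
  to the far right of the word according to its position relative to \<open>a + 1\<close>, and this changes only
  the first factor.
\<close>

section \<open>Words and the braid relation\<close>

lemma braid_rel_length_set:
  "(u, v) \<in> braid_rel n \<Longrightarrow> length u = length v \<and> set u = set v"
  by (induction rule: braid_rel.induct) auto

lemma braid_rel_distinct:
  assumes "(u, v) \<in> braid_rel n"
  shows "distinct u \<longleftrightarrow> distinct v"
  using braid_rel_length_set[OF assms] by (metis card_distinct distinct_card)

text \<open>Erasing letters from a commutation leaves a commutation or an equality. Distinctness
  excludes the braid relation, for which the claim fails: keeping only \<open>i\<close> gives one
  letter on one side and two on the other.\<close>

lemma braid_rel_filter:
  assumes "(u, v) \<in> braid_rel n" "distinct u"
  shows "(filter P u, filter P v) \<in> braid_rel n"
  using assms
proof (induction rule: braid_rel.induct)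
  case (comm i j)
  then show ?case by (auto intro: braid_rel.intros)
next
  case (braid i)
  then show ?case by simp
next
  case (refl u)
  then show ?case by (intro braid_rel.refl) auto
next
  case (sym u v)
  then show ?case using braid_rel_distinct braid_rel.sym by blast
next
  case (trans u v w)
  then show ?case using braid_rel_distinct braid_rel.trans by blast
next
  case (cong u u' v v')
  then show ?case by (auto intro: braid_rel.cong)
qed

text \<open>Neighbouring letters do not commute, so a commutation contains at most one of
  \<open>i\<close> and \<open>Suc i\<close>. The order of these two letters is therefore an
  invariant, which later tells a \<open>D\<close> from a \<open>U\<close>.\<close>

lemma braid_rel_filter_adjacent:
  assumes "(u, v) \<in> braid_rel n" "distinct u"
  shows "filter (\<lambda>x. x = i \<or> x = Suc i) u = filter (\<lambda>x. x = i \<or> x = Suc i) v"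
  using assms
proof (induction rule: braid_rel.induct)
  case (sym u v)
  then show ?case using braid_rel_distinct by metis
next
  case (trans u v w)
  then show ?case using braid_rel_distinct by metis
qed auto

section \<open>Moving letters past distant ones\<close>

lemma braid_rel_commute_letter:
  assumes "a \<in> gens n" "u \<in> lists (gens n)" "\<forall>x\<in>set u. \<bar>int a - int x\<bar> \<ge> 2"
  shows "(a # u, u @ [a]) \<in> braid_rel n"
  using assms(2,3)
proof (induction u rule: list.induct)
  case Nil
  then show ?case using assms(1) by (auto intro: braid_rel.refl)
next
  case (Cons x u)
  have "([a, x] @ u, [x, a] @ u) \<in> braid_rel n"
    using Cons.prems assms(1) by (intro braid_rel.cong braid_rel.comm braid_rel.refl) auto
  moreover have "([x] @ (a # u), [x] @ (u @ [a])) \<in> braid_rel n"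
    using Cons by (intro braid_rel.cong braid_rel.refl) auto
  ultimately show ?case using braid_rel.trans by fastforce
qed

lemma braid_rel_partition:
  assumes "w \<in> lists (gens n)"
    and "\<forall>x\<in>set w. \<forall>y\<in>set w. P x \<and> \<not> P y \<longrightarrow> \<bar>int x - int y\<bar> \<ge> 2"
  shows "(w, filter P w @ filter (\<lambda>x. \<not> P x) w) \<in> braid_rel n"
  using assms
proof (induction w rule: list.induct)
  case Nil
  then show ?case by (auto intro: braid_rel.refl)
next
  case (Cons x w)
  let ?f = "filter P w" and ?g = "filter (\<lambda>x. \<not> P x) w"
  have IH: "([x] @ w, [x] @ (?f @ ?g)) \<in> braid_rel n"
    using Cons by (intro braid_rel.cong braid_rel.refl) auto
  show ?case
  proof (cases "P x")
    case True
    then show ?thesis using IH by simp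
  next
    case False
    \<comment> \<open>The rejected letter \<open>x\<close> has to pass all kept letters, and these
      are at distance at least 2 from it.\<close>
    have "(x # ?f, ?f @ [x]) \<in> braid_rel n"
    proof (rule braid_rel_commute_letter)
      show "\<forall>y\<in>set ?f. 2 \<le> \<bar>int x - int y\<bar>"
        using Cons.prems(2) False by (auto simp: abs_minus_commute)
    qed (use Cons.prems(1) in auto)
    moreover have "?g \<in> lists (gens n)" using Cons.prems by auto
    ultimately have "((x # ?f) @ ?g, (?f @ [x]) @ ?g) \<in> braid_rel n"
      by (blast intro: braid_rel.cong braid_rel.refl)
    then show ?thesis using braid_rel.trans[OF IH, of "?f @ [x] @ ?g"] False by simp
  qed
qed

section \<open>Supports and products in terms of words\<close>

text \<open>All words for one braid have the same letters, so no factorization can produce a new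
  one; conversely, \<open>w\<close> can be split at any of its letters.\<close>

lemma supp_word_braid:
  assumes "w \<in> lists (gens n)"
  shows "supp n (word_braid n w) = set w"
proof
  show "supp n (word_braid n w) \<subseteq> set w"
  proof
    fix i assume "i \<in> supp n (word_braid n w)"
    then obtain u v where uv: "i \<in> gens n" "u \<in> lists (gens n)" "v \<in> lists (gens n)"
      "word_braid n w = word_braid n u \<otimes>\<^bsub>MB n\<^esub> gen n i \<otimes>\<^bsub>MB n\<^esub> word_braid n v"
      unfolding supp_def carrier_MB by blast
    then have "word_braid n w = word_braid n (u @ [i] @ v)"
      by (simp add: mult_word_braid)
    then have "(w, u @ [i] @ v) \<in> braid_rel n"
      using uv assms by (subst word_braid_eq_iff[symmetric]) auto
    then show "i \<in> set w" using braid_rel_length_set by fastforce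
  qed
  show "set w \<subseteq> supp n (word_braid n w)"
  proof
    fix i assume "i \<in> set w"
    then obtain u v where w: "w = u @ i # v" by (meson split_list)
    then have "word_braid n w = word_braid n u \<otimes>\<^bsub>MB n\<^esub> gen n i \<otimes>\<^bsub>MB n\<^esub> word_braid n v"
      using assms by (simp add: mult_word_braid)
    moreover have "word_braid n u \<in> carrier (MB n)" "word_braid n v \<in> carrier (MB n)"
      using assms w by (auto simp: carrier_MB)
    ultimately show "i \<in> supp n (word_braid n w)"
      using assms w unfolding supp_def by auto
  qed
qed

lemma concat_in_lists: "set ws \<subseteq> lists A \<Longrightarrow> concat ws \<in> lists A"
  by (induction ws) auto

lemma list_prod_word_braid:
  assumes "set ws \<subseteq> lists (gens n)"
  shows "list_prod n (map (word_braid n) ws) = word_braid n (concat ws)"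
  using assms
proof (induction ws)
  case Nil
  then show ?case by (simp add: list_prod_def one_MB)
next
  case (Cons w ws)
  moreover have "concat ws \<in> lists (gens n)" using Cons.prems concat_in_lists by auto
  ultimately show ?case by (auto simp: list_prod_def mult_word_braid)
qed

section \<open>Cycles are the simple braids supported on an interval\<close>

definition up_words :: "nat \<Rightarrow> nat list set"
  where "up_words n = {[a..<Suc b] | a b. 1 \<le> a \<and> a \<le> b \<and> b \<le> n - 1}"

definition down_words :: "nat \<Rightarrow> nat list set"
  where "down_words n = {rev [d..<Suc c] | c d. 1 \<le> d \<and> d < c \<and> c \<le> n - 1}"

definition adjacent_words :: "nat list \<Rightarrow> nat list \<Rightarrow> bool"
  where "adjacent_words u v \<longleftrightarrow>
    (\<exists>p q q'. p \<le> q \<and> q + 1 \<le> q' \<and> set u = {p..q} \<and> set v = {q + 1..q'})"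

definition cycle_words :: "nat \<Rightarrow> nat list list \<Rightarrow> bool"
  where "cycle_words n us \<longleftrightarrow> set us \<subseteq> up_words n \<union> down_words n \<and>
    successively adjacent_words us \<and>
    successively (\<lambda>u v. \<not> (u \<in> up_words n \<and> v \<in> up_words n)) us"

lemma up_words_lists: "u \<in> up_words n \<Longrightarrow> u \<in> lists (gens n)"
  by (auto simp: up_words_def gens_def)

lemma down_words_lists: "u \<in> down_words n \<Longrightarrow> u \<in> lists (gens n)"
  by (auto simp: down_words_def gens_def)

lemma is_U_iff: "is_U n F \<longleftrightarrow> (\<exists>u\<in>up_words n. F = word_braid n u)"
  unfolding is_U_def up_words_def U_def by blast

lemma is_D_iff: "is_D n F \<longleftrightarrow> (\<exists>u\<in>down_words n. F = word_braid n u)"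
  unfolding is_D_def down_words_def D_def by blast

text \<open>Restriction to the two letters \<open>d\<close> and \<open>d + 1\<close> shows their order in the word.\<close>

lemma not_is_U_down:
  assumes "u \<in> down_words n"
  shows "\<not> is_U n (word_braid n u)"
proof
  assume "is_U n (word_braid n u)"
  then obtain v where v: "v \<in> up_words n" "word_braid n u = word_braid n v"
    unfolding is_U_iff by blast
  then have rel: "(u, v) \<in> braid_rel n"
    using assms up_words_lists down_words_lists word_braid_eq_iff by blast
  obtain c d where u: "d < c" "u = rev [d..<Suc c]"
    using assms by (auto simp: down_words_def)
  obtain a b where v': "a \<le> b" "v = [a..<Suc b]"
    using v by (auto simp: up_words_def)
  have "{d..c} = {a..b}"
    using braid_rel_length_set[OF rel] u v' by (simp add: atLeastLessThanSuc_atLeastAtMost del: upt_Suc)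
  then have ab: "a = d" "b = c" using u v' by auto
  let ?P = "\<lambda>x. x = d \<or> x = Suc d"
  have split: "[d..<Suc c] = d # Suc d # [Suc (Suc d)..<Suc c]"
    using u by (simp add: upt_conv_Cons del: upt_Suc)
  have f0: "filter ?P [Suc (Suc d)..<Suc c] = []"
    by (auto simp: filter_empty_conv)
  have f: "filter ?P u = [Suc d, d]" "filter ?P v = [d, Suc d]"
    unfolding u v' ab split using f0 by (simp_all add: rev_filter[symmetric] del: upt_Suc)
  have "distinct u" using u by simp
  then show False using braid_rel_filter_adjacent[OF rel, of d] f by simp
qed

lemma up_words_down_words_disjoint: "u \<in> down_words n \<Longrightarrow> u \<notin> up_words n"
  using not_is_U_down is_U_iff by blast

lemma set_up_down_words:
  assumes "u \<in> up_words n \<union> down_words n"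
  shows "\<exists>p q. p \<le> q \<and> set u = {p..q}"
  using assms unfolding up_words_def down_words_def
  by (fastforce simp: atLeastLessThanSuc_atLeastAtMost simp del: upt_Suc)

lemma up_wordsE:
  assumes "u \<in> up_words n" "set u = {a..b}" "a \<le> b"
  shows "u = [a..<Suc b]"
proof -
  obtain p q where "p \<le> q" "u = [p..<Suc q]" using assms(1) by (auto simp: up_words_def)
  moreover from this have "{p..q} = {a..b}"
    using assms(2) by (simp add: atLeastLessThanSuc_atLeastAtMost del: upt_Suc)
  ultimately show ?thesis using assms(3) by simp
qed

lemma down_wordsE:
  assumes "u \<in> down_words n" "set u = {a..b}" "a \<le> b"
  shows "u = rev [a..<Suc b]" "a < b"
proof -
  obtain p q where pq: "p < q" "u = rev [p..<Suc q]" using assms(1) by (auto simp: down_words_def)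
  moreover from this have "{p..q} = {a..b}"
    using assms(2) by (simp add: atLeastLessThanSuc_atLeastAtMost del: upt_Suc)
  ultimately have "p = a \<and> q = b" using assms(3) by simp
  then show "u = rev [a..<Suc b]" "a < b" using pq by auto
qed

lemma cycle_words_Cons:
  "cycle_words n (u # us) \<longleftrightarrow> u \<in> up_words n \<union> down_words n \<and> cycle_words n us \<and>
    (us \<noteq> [] \<longrightarrow> adjacent_words u (hd us) \<and> \<not> (u \<in> up_words n \<and> hd us \<in> up_words n))"
  by (cases us) (auto simp: cycle_words_def)

lemma cycle_words_lists: "cycle_words n us \<Longrightarrow> set us \<subseteq> lists (gens n)"
  unfolding cycle_words_def using up_words_lists down_words_lists by blast

lemma adjacent_words_Icc:
  assumes "set u = {p..q}" "p \<le> q"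
  shows "adjacent_words u v \<longleftrightarrow> (\<exists>q'. q + 1 \<le> q' \<and> set v = {q + 1..q'})"
  unfolding adjacent_words_def using assms by (metis Icc_eq_Icc)

section \<open>Factoring a word on an interval into \<open>U\<close> and \<open>D\<close>
  words\<close>

text \<open>Downward induction on the lower end \<open>a\<close>. The first factor and its interval
  appear in the conclusion because a new smallest letter interacts with that factor alone.\<close>

lemma braid_rel_cycle_words:
  assumes "a \<le> b" "w \<in> lists (gens n)" "distinct w" "set w = {a..b}"
  shows "\<exists>u us q. cycle_words n (u # us) \<and> (w, u @ concat us) \<in> braid_rel n \<and>
    a \<le> q \<and> set u = {a..q}"
  using assms
proof (induction a arbitrary: w rule: inc_induct)
  case base
  then have "length w = 1" using distinct_card[of w] by simp
  then have "w = [b]" using base by (auto simp: length_Suc_conv)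
  moreover have "[b] \<in> up_words n"
    using base unfolding up_words_def gens_def by (fastforce intro: exI[of _ b])
  ultimately show ?case using base
    by (intro exI[of _ "[b]"] exI[of _ "[]"] exI[of _ b])
       (auto simp: cycle_words_def intro: braid_rel.refl)
next
  case (step m)
  \<comment> \<open>Delete the new smallest letter \<open>m\<close>, factor the remaining word
    \<open>x @ y\<close> by induction, then put \<open>m\<close> back.\<close>
  have "m \<in> set w" using step by auto
  then obtain x y where w: "w = x @ m # y" by (meson split_list)
  have xy: "x @ y \<in> lists (gens n)" "distinct (x @ y)" "set (x @ y) = {Suc m..b}" "m \<in> gens n"
  proof -
    have "set (x @ y) = set w - {m}" using step.prems(2) unfolding w by auto
    also have "\<dots> = {m..b} - {m}" using step.prems(3) by simp
    also have "\<dots> = {Suc m..b}" by auto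
    finally show "set (x @ y) = {Suc m..b}" .
  qed (use step.prems(1,2) w in auto)
  obtain u us q where IH: "cycle_words n (u # us)" "(x @ y, u @ concat us) \<in> braid_rel n"
    "Suc m \<le> q" "set u = {Suc m..q}"
    using step.IH[OF xy(1-3)] by blast
  note lists = cycle_words_lists[OF IH(1)]
  have q: "q \<le> n - 1" "1 \<le> m" "m \<le> n - 1"
    using lists IH(3,4) xy(4) by (auto simp: gens_def)
  have u: "u \<in> up_words n \<union> down_words n" "cycle_words n us"
    "us \<noteq> [] \<Longrightarrow> \<not> (u \<in> up_words n \<and> hd us \<in> up_words n)"
    "us \<noteq> [] \<Longrightarrow> \<exists>q'. q + 1 \<le> q' \<and> set (hd us) = {q + 1..q'}"
    using IH(1) adjacent_words_Icc[OF IH(4,3)] by (auto simp: cycle_words_Cons)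
  \<comment> \<open>Adjacency to the tail depends only on the upper end \<open>q\<close>, so
    \<open>u\<close> may be exchanged for another factor ending at \<open>q\<close>, as long as two
    \<open>U\<close> words do not meet.\<close>
  have new: "cycle_words n (v # us)"
    if "set v = {p..q}" "p \<le> q" "v \<in> up_words n \<union> down_words n"
      "us \<noteq> [] \<Longrightarrow> \<not> (v \<in> up_words n \<and> hd us \<in> up_words n)" for v p
    using that u by (auto simp: cycle_words_Cons adjacent_words_Icc)
  have dist: "distinct (u @ concat us)" "set (u @ concat us) = {Suc m..b}"
    using IH(2) xy braid_rel_distinct braid_rel_length_set by blast+
  \<comment> \<open>The letter \<open>Suc m\<close> occurs in \<open>u\<close> and letters are
    distinct, so \<open>m\<close> commutes with the whole tail.\<close>
  have us: "Suc (Suc m) \<le> z" if "z \<in> set (concat us)" for z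
  proof -
    have "z \<in> {Suc m..b}" using that dist(2) by auto
    moreover have "z \<noteq> Suc m" using that dist(1) IH(3,4) by (fastforce simp del: set_concat)
    ultimately show ?thesis by simp
  qed
  have uus: "u \<in> lists (gens n)" "concat us \<in> lists (gens n)" using lists concat_in_lists[of us] by auto
  show ?case
  proof (cases "Suc m \<in> set x")
    \<comment> \<open>Here \<open>Suc m\<close> stands to the right of \<open>m\<close>, so
      \<open>m\<close> commutes with \<open>x\<close> and moves to the far left.\<close>
    case False
    have "(m # x, x @ [m]) \<in> braid_rel n"
    proof (rule braid_rel_commute_letter)
      show "\<forall>z\<in>set x. 2 \<le> \<bar>int m - int z\<bar>"
      proof
        fix z assume "z \<in> set x"
        then have "z \<in> {Suc m..b}" "z \<noteq> Suc m" using xy(3) False by auto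
        then show "2 \<le> \<bar>int m - int z\<bar>" by auto
      qed
    qed (use xy in auto)
    from braid_rel.sym[OF this] have "((x @ [m]) @ y, (m # x) @ y) \<in> braid_rel n"
      using xy by (intro braid_rel.cong braid_rel.refl) auto
    moreover have "([m] @ (x @ y), [m] @ (u @ concat us)) \<in> braid_rel n"
      using xy(4) by (intro braid_rel.cong[OF _ IH(2)] braid_rel.refl) simp
    ultimately have rel: "(w, m # u @ concat us) \<in> braid_rel n"
      using braid_rel.trans[of w "m # x @ y"] by (simp add: w)
    show ?thesis
    proof (cases "u \<in> up_words n")
      \<comment> \<open>A first factor of type \<open>U\<close> absorbs \<open>m\<close> at its
        front.\<close>
      case True
      have eq: "m # u = [m..<Suc q]"
        using up_wordsE[OF True IH(4,3)] IH(3) by (simp add: upt_conv_Cons del: upt_Suc)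
      have set: "set (m # u) = {m..q}" using IH(3,4) by auto
      have "1 \<le> m \<and> m \<le> q \<and> q \<le> n - 1" using q IH(3) by simp
      then have "m # u \<in> up_words n" unfolding eq up_words_def by blast
      then have "cycle_words n ((m # u) # us)"
        using new[OF set] True u(3) IH(3) by auto
      then show ?thesis using rel set IH(3) by (intro exI[of _ "m # u"] exI[of _ us] exI[of _ q]) auto
    next
      \<comment> \<open>A first factor of type \<open>D\<close> stays as it is; \<open>m\<close>
        becomes a one-letter \<open>U\<close> before it, which creates no pair of consecutive
        \<open>U\<close> words.\<close>
      case False
      have "[m] \<in> up_words n"
        using q unfolding up_words_def by (fastforce intro: exI[of _ m])
      then have "cycle_words n ([m] # u # us)"
        using False IH by (subst cycle_words_Cons) (auto simp: adjacent_words_Icc[of _ m m])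
      then show ?thesis using rel by (intro exI[of _ "[m]"] exI[of _ "u # us"] exI[of _ m]) auto
    qed
  next
    \<comment> \<open>Here \<open>Suc m\<close> stands to the left of \<open>m\<close>, so
      \<open>m\<close> moves to the far right and then back past the tail, ending directly after
      \<open>u\<close>.\<close>
    case True
    have "(m # y, y @ [m]) \<in> braid_rel n"
    proof (rule braid_rel_commute_letter)
      show "\<forall>z\<in>set y. 2 \<le> \<bar>int m - int z\<bar>"
      proof
        fix z assume "z \<in> set y"
        then have "z \<in> {Suc m..b}" "z \<noteq> Suc m" using xy(2,3) True by auto
        then show "2 \<le> \<bar>int m - int z\<bar>" by auto
      qed
    qed (use xy in auto)
    then have "(x @ (m # y), x @ (y @ [m])) \<in> braid_rel n"
      using xy by (intro braid_rel.cong braid_rel.refl) auto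
    moreover have "((x @ y) @ [m], (u @ concat us) @ [m]) \<in> braid_rel n"
      using xy(4) by (intro braid_rel.cong[OF IH(2)] braid_rel.refl) simp
    moreover have "(m # concat us, concat us @ [m]) \<in> braid_rel n"
    proof (rule braid_rel_commute_letter)
      show "\<forall>z\<in>set (concat us). 2 \<le> \<bar>int m - int z\<bar>" using us by fastforce
    qed (use xy uus in auto)
    from braid_rel.sym[OF this] have "(u @ (concat us @ [m]), u @ (m # concat us)) \<in> braid_rel n"
      using uus by (intro braid_rel.cong braid_rel.refl) auto
    ultimately have rel: "(w, u @ m # concat us) \<in> braid_rel n"
      using braid_rel.trans[of w "x @ y @ [m]" n "u @ concat us @ [m]"]
        braid_rel.trans[of w "u @ concat us @ [m]" n "u @ m # concat us"] by (simp add: w)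
    have extend: ?thesis
      if "rev [m..<Suc r] = v" "r \<le> q" "m < r" "cycle_words n (v # vs)"
        "(u @ m # concat us, v @ concat vs) \<in> braid_rel n" for r v vs
    proof -
      have "set v = {m..r}" using that(1) by (auto simp del: upt_Suc)
      then show ?thesis using that braid_rel.trans[OF rel that(5)]
        by (intro exI[of _ v] exI[of _ vs] exI[of _ r]) auto
    qed
    have down: "rev [m..<Suc r] \<in> down_words n" if "m < r" "r \<le> q" for r
      using that q unfolding down_words_def by fastforce
    have refl: "(u @ m # concat us, u @ m # concat us) \<in> braid_rel n"
      using rel braid_rel.sym braid_rel.trans by blast
    have full: "cycle_words n (rev [m..<Suc q] # us)"
      using new[of "rev [m..<Suc q]" m] down[of q] IH(3) up_words_down_words_disjoint
      by (auto simp: atLeastLessThanSuc_atLeastAtMost simp del: upt_Suc)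
    show ?thesis
    \<comment> \<open>This is the case in which \<open>u\<close> ends with \<open>Suc m\<close>, so
      that appending \<open>m\<close> gives one descending word.\<close>
    proof (cases "u \<in> down_words n \<or> q = Suc m")
      case True
      have "rev [m..<Suc q] = u @ [m]"
      proof (cases "u \<in> down_words n")
        case True
        then show ?thesis
          using down_wordsE[OF True IH(4,3)] IH(3) by (simp add: upt_conv_Cons del: upt_Suc)
      next
        case False
        then have "u \<in> up_words n" "q = Suc m" using u(1) True by auto
        from up_wordsE[OF this(1) IH(4,3)] this(2) show ?thesis by simp
      qed
      then show ?thesis using extend[of q "u @ [m]" us] full refl IH(3) by simp
    next
      \<comment> \<open>Now \<open>u\<close> is a \<open>U\<close> with at least two letters. Moving
        \<open>m\<close> left past \<open>?t\<close> turns \<open>u @ [m]\<close> into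
        \<open>[Suc m, m] @ ?t\<close>, a \<open>D\<close> followed by a \<open>U\<close>.\<close>
      case False
      let ?t = "[Suc (Suc m)..<Suc q]"
      have up: "u \<in> up_words n" and less: "Suc m < q" using False u(1) IH(3) by auto
      have ueq: "u = Suc m # ?t"
        using up_wordsE[OF up IH(4,3)] IH(3) by (simp add: upt_conv_Cons del: upt_Suc)
      have t: "?t \<in> up_words n" "set ?t = {Suc (Suc m)..q}"
        using less q unfolding up_words_def
        by (fastforce, auto simp del: upt_Suc)
      have "cycle_words n (?t # us)" using new[OF t(2)] t(1) less up u(3) by auto
      moreover have "adjacent_words [Suc m, m] ?t"
        using less t(2) by (subst adjacent_words_Icc[of _ m "Suc m"]) (auto simp del: upt_Suc)
      moreover have "[Suc m, m] \<in> down_words n" using down[of "Suc m"] less by simp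
      ultimately have cyc: "cycle_words n ([Suc m, m] # ?t # us)"
        using up_words_down_words_disjoint by (subst cycle_words_Cons) auto
      have "(m # ?t, ?t @ [m]) \<in> braid_rel n"
      proof (rule braid_rel_commute_letter)
        show "?t \<in> lists (gens n)" using t(1) up_words_lists by blast
      qed (use xy t(2) in \<open>auto simp del: upt_Suc\<close>)
      from braid_rel.sym[OF this]
      have "([Suc m] @ (?t @ [m]) @ concat us, [Suc m] @ (m # ?t) @ concat us) \<in> braid_rel n"
        using uus ueq by (intro braid_rel.cong braid_rel.refl) auto
      moreover have "[m..<Suc (Suc m)] = [m, Suc m]" by simp
      ultimately show ?thesis
        using extend[of "Suc m" "[Suc m, m]" "?t # us"] cyc less ueq by (simp del: upt_Suc)
    qed
  qed
qed

section \<open>Cycles and words whose letters form an interval\<close>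

text \<open>Abutting intervals glue together. The interval of the head is tracked because its lower
  end is what a new first word must meet.\<close>

lemma set_concat_adjacent_words:
  assumes "successively adjacent_words us" "us \<noteq> []" "\<forall>u\<in>set us. \<exists>p q. p \<le> q \<and> set u = {p..q}"
  shows "\<exists>a q b. a \<le> q \<and> q \<le> b \<and> set (hd us) = {a..q} \<and> set (concat us) = {a..b}"
  using assms
proof (induction us)
  case (Cons u us)
  obtain p q where u: "p \<le> q" "set u = {p..q}" using Cons.prems by auto
  show ?case
  proof (cases "us = []")
    case True
    then show ?thesis using u by auto
  next
    case False
    then obtain a r b where IH: "a \<le> r" "r \<le> b" "set (hd us) = {a..r}" "set (concat us) = {a..b}"
      using Cons by (auto simp: successively_Cons)
    have "adjacent_words u (hd us)" using False Cons.prems by (simp add: successively_Cons)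
    then have "a = q + 1" using adjacent_words_Icc[OF u(2,1)] IH by (metis Icc_eq_Icc)
    then have "set (concat (u # us)) = {p..b}" using u IH by auto
    moreover have "q \<le> b" using IH \<open>a = q + 1\<close> by simp
    ultimately show ?thesis using u by (metis list.sel(1))
  qed
qed simp

definition interval_word :: "nat \<Rightarrow> nat list \<Rightarrow> bool"
  where "interval_word n w \<longleftrightarrow> w \<in> lists (gens n) \<and> (\<exists>a b. a \<le> b \<and> set w = {a..b})"

lemma is_cycle_word:
  assumes "is_cycle n \<gamma>"
  shows "\<exists>w. interval_word n w \<and> \<gamma> = word_braid n w"
proof -
  obtain Fs where Fs: "Fs \<noteq> []" "\<gamma> = list_prod n Fs" "\<forall>F\<in>set Fs. is_U n F \<or> is_D n F"
    "successively (consecutive n) Fs"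
    using assms unfolding is_cycle_def by blast
  \<comment> \<open>Phrased with \<open>lists\<close> of an image so that \<open>lists_image\<close>
    chooses words for all factors at once.\<close>
  have "Fs \<in> lists (word_braid n ` (up_words n \<union> down_words n))"
    using Fs(3) unfolding is_U_iff is_D_iff by auto
  then obtain us where us: "Fs = map (word_braid n) us" "set us \<subseteq> up_words n \<union> down_words n"
    unfolding lists_image by auto
  then have lists: "set us \<subseteq> lists (gens n)" using up_words_lists down_words_lists by blast
  have "successively (\<lambda>u v. consecutive n (word_braid n u) (word_braid n v)) us"
    using Fs(4) us(1) by (simp add: successively_map)
  then have "successively adjacent_words us"
    using lists
    by (rule_tac successively_mono[rotated])
       (auto simp: consecutive_def adjacent_words_def supp_word_braid subset_iff)
  then obtain a b where "a \<le> b" "set (concat us) = {a..b}"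
    using set_concat_adjacent_words[of us] set_up_down_words us Fs(1)
    by (metis list.map_disc_iff order_trans subsetD)
  moreover have "\<gamma> = word_braid n (concat us)" using Fs(2) us(1) lists list_prod_word_braid by simp
  moreover have "concat us \<in> lists (gens n)" using lists by (rule concat_in_lists)
  ultimately show ?thesis unfolding interval_word_def by blast
qed

lemma is_cycle_word_braid:
  assumes "a \<le> b" "w \<in> lists (gens n)" "distinct w" "set w = {a..b}"
  shows "is_cycle n (word_braid n w)"
proof -
  obtain u us where us: "cycle_words n (u # us)" "(w, u @ concat us) \<in> braid_rel n"
    using braid_rel_cycle_words[OF assms] by blast
  note lists = cycle_words_lists[OF us(1)]
  let ?Fs = "map (word_braid n) (u # us)"
  have "word_braid n w = word_braid n (u @ concat us)"
    using us(2) word_braid_eq_iff braid_rel_words by blast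
  then have "word_braid n w = list_prod n ?Fs"
    using list_prod_word_braid[OF lists] by simp
  moreover have "\<forall>F\<in>set ?Fs. is_U n F \<or> is_D n F"
    using us(1) unfolding cycle_words_def is_U_iff is_D_iff by auto
  moreover have "successively (consecutive n) ?Fs"
    unfolding successively_map
  proof (rule successively_mono)
    show "successively adjacent_words (u # us)" using us(1) by (simp add: cycle_words_def)
  qed (use lists in \<open>auto simp: consecutive_def adjacent_words_def supp_word_braid subset_iff\<close>)
  \<comment> \<open>The condition on words carries over to classes because the class of a down word
    is never a \<open>U\<close>.\<close>
  moreover have "successively (\<lambda>F G. \<not> (is_U n F \<and> is_U n G)) ?Fs"
    unfolding successively_map
  proof (rule successively_mono)
    show "successively (\<lambda>u v. \<not> (u \<in> up_words n \<and> v \<in> up_words n)) (u # us)"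
      using us(1) by (simp add: cycle_words_def)
  qed (use us(1) not_is_U_down in \<open>auto simp: cycle_words_def\<close>)
  moreover have "word_braid n w \<noteq> \<one>\<^bsub>MB n\<^esub>"
  proof
    assume "word_braid n w = \<one>\<^bsub>MB n\<^esub>"
    then have "(w, []) \<in> braid_rel n"
      using assms(2) word_braid_eq_iff[of w n "[]"] by (simp add: one_MB)
    then show False using braid_rel_length_set assms(1,4) by fastforce
  qed
  moreover have "word_braid n w \<in> SB n" using assms by (auto simp: SB_def)
  ultimately show ?thesis unfolding is_cycle_def by blast
qed

section \<open>Decomposition into disjoint cycles\<close>

definition separated :: "nat list \<Rightarrow> nat list \<Rightarrow> bool"
  where "separated u v \<longleftrightarrow> (\<forall>x\<in>set u. \<forall>y\<in>set v. x + 2 \<le> y)"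

text \<open>A nonempty interval determines its ends, so the quantified bounds in
  \<open>disjoint_cycles\<close> are the actual ends of the letter sets.\<close>

lemma disjoint_cycles_word_braid:
  assumes "interval_word n u" "interval_word n v"
  shows "disjoint_cycles n (word_braid n u) (word_braid n v) \<longleftrightarrow> separated u v"
proof -
  obtain a b c d where abcd: "a \<le> b" "c \<le> d" "set u = {a..b}" "set v = {c..d}"
    using assms by (auto simp: interval_word_def)
  have supp: "supp n (word_braid n u) = {a..b}" "supp n (word_braid n v) = {c..d}"
    using assms abcd by (simp_all add: interval_word_def supp_word_braid)
  have "disjoint_cycles n (word_braid n u) (word_braid n v) \<longleftrightarrow> b + 2 \<le> c"
  proof
    assume "disjoint_cycles n (word_braid n u) (word_braid n v)"
    then obtain a' b' c' d' where "a' \<le> b'" "c' \<le> d'" "{a..b} = {a'..b'}" "{c..d} = {c'..d'}"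
      "b' + 2 \<le> c'"
      unfolding disjoint_cycles_def supp by blast
    then show "b + 2 \<le> c" using abcd by simp
  next
    assume "b + 2 \<le> c"
    moreover from this have "b + 1 \<le> c" by simp
    ultimately show "disjoint_cycles n (word_braid n u) (word_braid n v)"
      unfolding disjoint_cycles_def prec_def supp using abcd(1,2) by blast
  qed
  also have "\<dots> \<longleftrightarrow> separated u v"
    unfolding separated_def using abcd by fastforce
  finally show ?thesis .
qed

section \<open>Existence of the decomposition, for words\<close>

text \<open>Split off the leftmost maximal interval of letters: the index after it is missing, so
  its letters commute with all others. The rest is shorter.\<close>

lemma braid_rel_concat_intervals:
  assumes "w \<in> lists (gens n)" "distinct w"
  shows "\<exists>ws. (\<forall>v\<in>set ws. interval_word n v \<and> distinct v) \<and> sorted_wrt separated ws \<and>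
    (w, concat ws) \<in> braid_rel n"
  using assms
proof (induction "length w" arbitrary: w rule: less_induct)
  case less
  show ?case
  proof (cases "w = []")
    case True
    then show ?thesis by (intro exI[of _ "[]"]) (auto intro: braid_rel.refl)
  next
    case False
    define a where "a = Min (set w)"
    \<comment> \<open>The last index of the unbroken run of letters starting at the minimum
      \<open>a\<close>.\<close>
    define b where "b = Max {b. a \<le> b \<and> {a..b} \<subseteq> set w}"
    have a: "a \<in> set w" "\<And>x. x \<in> set w \<Longrightarrow> a \<le> x" using False by (simp_all add: a_def)
    have sub: "{b. a \<le> b \<and> {a..b} \<subseteq> set w} \<subseteq> set w" by auto
    then have fin: "finite {b. a \<le> b \<and> {a..b} \<subseteq> set w}" using finite_subset by blast
    have "a \<in> {b. a \<le> b \<and> {a..b} \<subseteq> set w}" using a by auto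
    then have b: "a \<le> b" "{a..b} \<subseteq> set w" using Max_in[OF fin] unfolding b_def by blast+
    have "Suc b \<notin> set w"
    proof
      assume "Suc b \<in> set w"
      then have "Suc b \<in> {b. a \<le> b \<and> {a..b} \<subseteq> set w}"
        using b by (auto simp: atLeastAtMostSuc_conv)
      then show False using Max_ge[OF fin] unfolding b_def by fastforce
    qed
    let ?P = "\<lambda>x. x \<le> b"
    let ?u = "filter ?P w" and ?v = "filter (\<lambda>x. \<not> ?P x) w"
    have far: "x + 2 \<le> y" if "y \<in> set ?v" "x \<le> b" for x y
    proof -
      have "y \<noteq> Suc b" using that(1) \<open>Suc b \<notin> set w\<close> by auto
      then show ?thesis using that by auto
    qed
    have rel: "(w, ?u @ ?v) \<in> braid_rel n"
      using less.prems(1) far by (intro braid_rel_partition) fastforce+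
    have u: "set ?u = {a..b}" using a b by auto
    have "length ?v < length w"
      using a(1) b(1) by (intro length_filter_less) auto
    then obtain ws where ws: "\<forall>v\<in>set ws. interval_word n v \<and> distinct v" "sorted_wrt separated ws"
      "(?v, concat ws) \<in> braid_rel n"
      using less.hyps[of ?v] less.prems by fastforce
    have "(?u @ ?v, ?u @ concat ws) \<in> braid_rel n"
      using ws(3) less.prems(1) by (intro braid_rel.cong braid_rel.refl) auto
    from braid_rel.trans[OF rel this] have "(w, concat (?u # ws)) \<in> braid_rel n" by simp
    \<comment> \<open>The words in \<open>ws\<close> only contain letters of \<open>?v\<close>, all
      of which are at least \<open>b + 2\<close>.\<close>
    moreover have "separated ?u v" if "v \<in> set ws" for v
      unfolding separated_def
    proof (intro ballI)
      fix x y assume "x \<in> set ?u" "y \<in> set v"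
      then have "y \<in> set (concat ws)" "x \<le> b" using that by auto
      then show "x + 2 \<le> y" using far braid_rel_length_set[OF ws(3)] by blast
    qed
    moreover have "interval_word n ?u"
      using less.prems(1) b(1) u unfolding interval_word_def by auto
    ultimately show ?thesis
      using ws less.prems(2) by (intro exI[of _ "?u # ws"]) auto
  qed
qed

section \<open>Uniqueness of the decomposition, for words\<close>

text \<open>The lower end is the minimum of the union, and the upper end is followed by the first
  index missing from it; both depend on the union alone.\<close>

lemma leftmost_interval_unique:
  fixes a b c d :: nat
  assumes "a \<le> b" "c \<le> d" "{a..b} \<union> R = {c..d} \<union> S"
    and "\<forall>y\<in>R. b + 2 \<le> y" "\<forall>y\<in>S. d + 2 \<le> y"
  shows "a = c \<and> b = d"
proof -
  have mem: "x \<in> {a..b} \<or> x \<in> R \<longleftrightarrow> x \<in> {c..d} \<or> x \<in> S" for x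
    using assms(3) by blast
  have R: "b + 2 \<le> y" if "y \<in> R" for y using that assms(4) by blast
  have S: "d + 2 \<le> y" if "y \<in> S" for y using that assms(5) by blast
  have "a = c" using mem[of a] mem[of c] assms(1,2) R[of c] S[of a] by auto
  moreover have "\<not> b < d"
    using mem[of "b + 1"] assms(1,2) R[of "b + 1"] \<open>a = c\<close> by auto
  moreover have "\<not> d < b"
    using mem[of "d + 1"] assms(1,2) S[of "d + 1"] \<open>a = c\<close> by auto
  ultimately show ?thesis by simp
qed

text \<open>Both lists start with the same interval of letters. Restricting to the letters up to its
  upper end, and to those beyond, recovers the first word and the remaining product on each
  side.\<close>

lemma word_braid_intervals_unique:
  assumes "\<forall>w\<in>set us. interval_word n w" "sorted_wrt separated us"
    and "\<forall>w\<in>set vs. interval_word n w" "sorted_wrt separated vs"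
    and "(concat us, concat vs) \<in> braid_rel n" "distinct (concat us)"
  shows "map (word_braid n) us = map (word_braid n) vs"
  using assms
proof (induction us arbitrary: vs)
  case Nil
  have "concat vs = []" using braid_rel_length_set[OF Nil.prems(5)] by simp
  moreover have "v \<noteq> []" if "v \<in> set vs" for v
    using that Nil.prems(3) by (fastforce simp: interval_word_def)
  ultimately have "vs = []" by (cases vs) auto
  then show ?case by simp
next
  case (Cons u us vs')
  obtain a b where u: "a \<le> b" "set u = {a..b}"
    using Cons.prems(1) by (auto simp: interval_word_def)
  have set_eq: "set (concat (u # us)) = set (concat vs')"
    using braid_rel_length_set[OF Cons.prems(5)] by simp
  then obtain v vs where vs': "vs' = v # vs" using u by (cases vs') auto
  obtain c d where v: "c \<le> d" "set v = {c..d}"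
    using Cons.prems(3) vs' by (auto simp: interval_word_def)
  have R: "\<forall>y\<in>set (concat us). b + 2 \<le> y"
    using Cons.prems(2) u by (force simp: separated_def)
  have S: "\<forall>y\<in>set (concat vs). d + 2 \<le> y"
    using Cons.prems(4) v vs' by (force simp: separated_def)
  have "{a..b} \<union> set (concat us) = {c..d} \<union> set (concat vs)"
    using set_eq u v vs' by simp
  then have eq: "d = b" using leftmost_interval_unique[OF u(1) v(1)] R S by blast
  let ?P = "\<lambda>x. x \<le> b"
  \<comment> \<open>Since \<open>d = b\<close>, the same cut at \<open>b\<close> separates head from
    tail in both concatenations.\<close>
  have "filter ?P u = u" "filter ?P v = v" "filter ?P (concat us) = []" "filter ?P (concat vs) = []"
    "filter (\<lambda>x. \<not> ?P x) u = []" "filter (\<lambda>x. \<not> ?P x) v = []"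
    "filter (\<lambda>x. \<not> ?P x) (concat us) = concat us" "filter (\<lambda>x. \<not> ?P x) (concat vs) = concat vs"
    unfolding filter_id_conv filter_empty_conv
    using u v R S eq by (fastforce simp del: set_concat)+
  then have filters: "filter ?P (concat (u # us)) = u" "filter ?P (concat vs') = v"
    "filter (\<lambda>x. \<not> ?P x) (concat (u # us)) = concat us"
    "filter (\<lambda>x. \<not> ?P x) (concat vs') = concat vs"
    unfolding vs' concat.simps filter_append by simp_all
  have "(u, v) \<in> braid_rel n" "(concat us, concat vs) \<in> braid_rel n"
    using braid_rel_filter[OF Cons.prems(5,6), of ?P]
      braid_rel_filter[OF Cons.prems(5,6), of "\<lambda>x. \<not> ?P x"]
    unfolding filters by blast+
  moreover from this(1) have "word_braid n u = word_braid n v"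
    using word_braid_eq_iff braid_rel_words by blast
  ultimately show ?case using Cons.IH[of vs] Cons.prems vs' by simp
qed

section \<open>Transfer from words to braids\<close>

theorem theorem1p8:
  fixes n :: nat and \<alpha> :: "nat list set"
  assumes "\<alpha> \<in> SB n"
  shows "\<exists>!\<gamma>s. (\<forall>\<gamma>\<in>set \<gamma>s. is_cycle n \<gamma>) \<and>
                successively (prec n) \<gamma>s \<and>
                sorted_wrt (disjoint_cycles n) \<gamma>s \<and>
                \<alpha> = list_prod n \<gamma>s"
proof -
  obtain w where w: "w \<in> lists (gens n)" "distinct w" "\<alpha> = word_braid n w"
    using assms by (auto simp: SB_def)
  \<comment> \<open>This and \<open>rel\<close> translate the conditions on lists of braids into
    conditions on words, for existence and uniqueness alike.\<close>
  have sorted: "sorted_wrt (disjoint_cycles n) (map (word_braid n) ws) \<longleftrightarrow> sorted_wrt separated ws"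
    if "\<forall>v\<in>set ws. interval_word n v" for ws
    using that by (induction ws) (auto simp: disjoint_cycles_word_braid)
  have rel: "\<alpha> = list_prod n (map (word_braid n) ws) \<longleftrightarrow> (w, concat ws) \<in> braid_rel n"
    if "\<forall>v\<in>set ws. interval_word n v" for ws
  proof -
    have "set ws \<subseteq> lists (gens n)" using that by (auto simp: interval_word_def)
    moreover from this have "concat ws \<in> lists (gens n)" by (rule concat_in_lists)
    ultimately show ?thesis using w word_braid_eq_iff by (simp add: list_prod_word_braid)
  qed
  show ?thesis
  proof (rule ex_ex1I)
    obtain ws where ws: "\<forall>v\<in>set ws. interval_word n v \<and> distinct v" "sorted_wrt separated ws"
      "(w, concat ws) \<in> braid_rel n"
      using braid_rel_concat_intervals w by blast
    let ?\<gamma>s = "map (word_braid n) ws"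
    have "\<forall>\<gamma>\<in>set ?\<gamma>s. is_cycle n \<gamma>"
      using ws(1) is_cycle_word_braid unfolding interval_word_def by fastforce
    moreover have disj: "sorted_wrt (disjoint_cycles n) ?\<gamma>s" using ws sorted by blast
    \<comment> \<open>Disjointness contains \<open>prec\<close> and holds for all pairs, in
      particular for neighbours.\<close>
    moreover have "successively (prec n) ?\<gamma>s"
      using sorted_wrt_mono_rel[OF _ disj, of "prec n"]
      by (auto simp: disjoint_cycles_def intro: successively_if_sorted_wrt)
    moreover have "\<alpha> = list_prod n ?\<gamma>s" using ws rel by blast
    ultimately show "\<exists>\<gamma>s. (\<forall>\<gamma>\<in>set \<gamma>s. is_cycle n \<gamma>) \<and> successively (prec n) \<gamma>s \<and>
        sorted_wrt (disjoint_cycles n) \<gamma>s \<and> \<alpha> = list_prod n \<gamma>s"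
      by blast
  next
    fix \<gamma>s \<delta>s
    assume \<gamma>s: "(\<forall>\<gamma>\<in>set \<gamma>s. is_cycle n \<gamma>) \<and> successively (prec n) \<gamma>s \<and>
        sorted_wrt (disjoint_cycles n) \<gamma>s \<and> \<alpha> = list_prod n \<gamma>s"
      and \<delta>s: "(\<forall>\<gamma>\<in>set \<delta>s. is_cycle n \<gamma>) \<and> successively (prec n) \<delta>s \<and>
        sorted_wrt (disjoint_cycles n) \<delta>s \<and> \<alpha> = list_prod n \<delta>s"
    have words: "\<exists>ws. \<gamma>s = map (word_braid n) ws \<and> (\<forall>v\<in>set ws. interval_word n v)"
      if "\<forall>\<gamma>\<in>set \<gamma>s. is_cycle n \<gamma>" for \<gamma>s
    proof -
      have "\<gamma>s \<in> lists (word_braid n ` {v. interval_word n v})"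
        using that is_cycle_word by (auto simp: in_lists_conv_set image_iff)
      then show ?thesis unfolding lists_image by (auto simp: in_lists_conv_set)
    qed
    obtain us where us: "\<gamma>s = map (word_braid n) us" "\<forall>v\<in>set us. interval_word n v"
      using words \<gamma>s by blast
    obtain vs where vs: "\<delta>s = map (word_braid n) vs" "\<forall>v\<in>set vs. interval_word n v"
      using words \<delta>s by blast
    have r: "(w, concat us) \<in> braid_rel n" "(w, concat vs) \<in> braid_rel n"
      using rel us vs \<gamma>s \<delta>s by blast+
    \<comment> \<open>Distinctness is inherited from \<open>w\<close>, which makes restriction to
      sets of letters available.\<close>
    then have "(concat us, concat vs) \<in> braid_rel n" "distinct (concat us)"
      using w(2) braid_rel_distinct braid_rel.sym braid_rel.trans by blast+
    then show "\<gamma>s = \<delta>s"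
      using word_braid_intervals_unique us vs sorted \<gamma>s \<delta>s by blast
  qed
qed

end
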